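(* Let $p$ be a prime and $d, n \in \mathbb{N}$. Let $\tau_1,\dots,\tau_n \in \mathbb{Q}_p^d$ satisfy: (i) $\langle \tau_j, \tau_j\rangle = 1$ for all $1 \leq j \leq n$; (ii) the $\mathbb{Q}_p$-linear operator $S_\tau : \mathbb{Q}_p^d \to \mathbb{Q}_p^d$, $S_\tau x = \sum_{j=1}^n \langle x, \tau_j\rangle \tau_j$, is similar (via an invertible $\mathbb{Q}_p$-linear operator) to a diagonal operator with eigenvalues $\lambda_1,\dots,\lambda_d \in \mathbb{Q}_p$ satisfying $\left|\sum_{j=1}^d \lambda_j\right|^2 \leq |d| \left|\sum_{j=1}^d \lambda_j^2\right|$. Then $$|n|^2 \leq |d| \max\left(\{|n|\} \cup \{|\langle \tau_j, \tau_k\rangle|^2 : 1 \leq j,k \leq n,\ j \neq k\}\right).$$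
   Context: $\mathbb{Q}_p$ denotes the field of $p$-adic numbers with the $p$-adic absolute value $|\cdot|$; for a positive integer $m$, $|m|$ denotes the $p$-adic absolute value of $m$ regarded as an element of $\mathbb{Q}_p$. On $\mathbb{Q}_p^d$ the (bilinear) p-adic inner product is $\langle (a_j)_{j=1}^d, (b_j)_{j=1}^d\rangle = \sum_{j=1}^d a_j b_j$. *)

theory Defs
  imports "HOL-Analysis.Analysis" "HOL-Computational_Algebra.Squarefree" "Berlekamp_Zassenhaus.Finite_Field"
begin

section \<open>The \<open>p\<close>-adic absolute value on the rationals\<close>

text \<open>If \<open>q = a / b\<close> in lowest terms, then \<open>|q| = p ^ (v b - v a)\<close> with \<open>v\<close> the multiplicity of \<open>p\<close>.\<close>

definition padic_abs_rat :: "nat \<Rightarrow> rat \<Rightarrow> real" where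
  "padic_abs_rat p q =
     (if q = 0 then 0
      else real p powi (int (multiplicity (int p) (snd (quotient_of q)))
                        - int (multiplicity (int p) (fst (quotient_of q)))))"

lemma padic_abs_rat_Fract:
  assumes p: "prime p" and a: "a \<noteq> 0" and b: "b \<noteq> 0"
  shows "padic_abs_rat p (Rat.Fract a b) =
    real p powi (int (multiplicity (int p) b) - int (multiplicity (int p) a))"
proof -
  obtain c d where cd: "quotient_of (Rat.Fract a b) = (c, d)" by force
  have d: "d > 0" using quotient_of_denom_pos[OF cd] .
  have eq: "Rat.Fract a b = Rat.Fract c d"
    using quotient_of_div[OF cd] by (simp add: Fract_of_int_quotient)
  have mul: "a * d = c * b" using eq b d by (simp add: eq_rat)
  have nz: "Rat.Fract a b \<noteq> 0" using a b by (simp add: Zero_rat_def eq_rat)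
  have c: "c \<noteq> 0" using mul a d by auto
  have pp: "prime (int p)" using p by simp
  have "multiplicity (int p) (a * d) = multiplicity (int p) (c * b)" using mul by simp
  then have "multiplicity (int p) a + multiplicity (int p) d
      = multiplicity (int p) c + multiplicity (int p) b"
    using pp a b c d by (simp add: prime_elem_multiplicity_mult_distrib)
  then have "int (multiplicity (int p) d) - int (multiplicity (int p) c)
      = int (multiplicity (int p) b) - int (multiplicity (int p) a)" by linarith
  then show ?thesis using nz by (simp add: padic_abs_rat_def cd)
qed

lemma padic_abs_rat_zero [simp]: "padic_abs_rat p 0 = 0"
  by (simp add: padic_abs_rat_def)

lemma padic_abs_rat_nonneg [simp]: "padic_abs_rat p x \<ge> 0"
  by (simp add: padic_abs_rat_def)

lemma padic_abs_rat_eq_0_iff [simp]: "prime p \<Longrightarrow> padic_abs_rat p x = 0 \<longleftrightarrow> x = 0"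
  by (auto simp: padic_abs_rat_def)

lemma padic_abs_rat_one [simp]: "padic_abs_rat p 1 = 1"
  by (simp add: padic_abs_rat_def)

lemma padic_abs_rat_mult:
  assumes p: "prime p"
  shows "padic_abs_rat p (x * y) = padic_abs_rat p x * padic_abs_rat p y"
proof (cases "x = 0 \<or> y = 0")
  case False
  obtain a b where x: "x = Rat.Fract a b" "b > 0" by (cases x)
  obtain c d where y: "y = Rat.Fract c d" "d > 0" by (cases y)
  have nz: "a \<noteq> 0" "c \<noteq> 0" using False x y by (auto simp: rat_number_collapse)
  have pp: "prime (int p)" "real p \<noteq> 0" using p by auto
  show ?thesis
    using nz x y pp
    by (simp add: padic_abs_rat_Fract[OF p] prime_elem_multiplicity_mult_distrib
        algebra_simps flip: power_int_add)
qed auto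

lemma padic_abs_rat_minus [simp]: "padic_abs_rat p (- x) = padic_abs_rat p x"
  by (auto simp: padic_abs_rat_def rat_uminus_code multiplicity_uminus_right split: prod.splits)

lemma padic_abs_rat_diff_commute: "padic_abs_rat p (x - y) = padic_abs_rat p (y - x)"
  using padic_abs_rat_minus[of p "x - y"] by simp

lemma padic_abs_rat_inverse:
  assumes p: "prime p"
  shows "padic_abs_rat p (inverse x) = inverse (padic_abs_rat p x)"
proof (cases "x = 0")
  case False
  then have "padic_abs_rat p x * padic_abs_rat p (inverse x) = 1"
    using padic_abs_rat_mult[OF p, of x "inverse x"] by simp
  then show ?thesis by (metis inverse_unique)
qed auto

lemma padic_abs_rat_ultrametric:
  assumes p: "prime p"
  shows "padic_abs_rat p (x + y) \<le> max (padic_abs_rat p x) (padic_abs_rat p y)"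
proof (cases "x = 0 \<or> y = 0 \<or> x + y = 0")
  case False
  obtain a' b' where x': "x = Rat.Fract a' b'" "b' > 0" by (cases x)
  obtain c' d' where y': "y = Rat.Fract c' d'" "d' > 0" by (cases y)
  define a b c where "a = a' * d'" and "b = b' * d'" and "c = c' * b'"
  have b: "b > 0" using x' y' by (simp add: b_def)
  have x: "x = Rat.Fract a b" using x' y' by (simp add: a_def b_def eq_rat)
  have y: "y = Rat.Fract c b" using x' y' by (simp add: c_def b_def eq_rat)
  have xy: "x + y = Rat.Fract (a + c) b" using x' y' by (simp add: a_def b_def c_def)
  have nz: "a \<noteq> 0" "c \<noteq> 0" "a + c \<noteq> 0"
    using False x y xy by (auto simp: rat_number_collapse)
  define v where "v = multiplicity (int p)"
  have "int p ^ min (v a) (v c) dvd a + c"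
    by (intro dvd_add; rule multiplicity_dvd') (auto simp: v_def)
  then have "min (v a) (v c) \<le> v (a + c)"
    unfolding v_def using nz p by (intro multiplicity_geI) auto
  moreover have p1: "real p > 1" using p prime_gt_1_nat by auto
  ultimately have "real p powi (int (v b) - int (v (a + c)))
      \<le> real p powi (int (v b) - int (min (v a) (v c)))"
    by (intro power_int_increasing) auto
  also have "\<dots> \<le> max (real p powi (int (v b) - int (v a))) (real p powi (int (v b) - int (v c)))"
    by (auto simp: min_def)
  finally show ?thesis
    using nz b unfolding xy by (simp add: x y padic_abs_rat_Fract[OF p] v_def)
qed (auto simp: le_max_iff_disj)

lemma padic_abs_rat_triangle:
  "prime p \<Longrightarrow> padic_abs_rat p (x + y) \<le> padic_abs_rat p x + padic_abs_rat p y"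
  using padic_abs_rat_ultrametric[of p x y]
    padic_abs_rat_nonneg[of p x] padic_abs_rat_nonneg[of p y] by linarith

lemma padic_abs_rat_reverse_triangle:
  assumes "prime p"
  shows "\<bar>padic_abs_rat p x - padic_abs_rat p y\<bar> \<le> padic_abs_rat p (x - y)"
  using padic_abs_rat_triangle[OF assms, of "x - y" y] padic_abs_rat_triangle[OF assms, of "y - x" x]
    padic_abs_rat_diff_commute[of p x y] by simp

section \<open>Cauchy sequences and null sequences\<close>

definition padic_Cauchy :: "nat \<Rightarrow> (nat \<Rightarrow> rat) \<Rightarrow> bool" where
  "padic_Cauchy p X \<longleftrightarrow> (\<forall>e>0. \<exists>N. \<forall>m\<ge>N. \<forall>n\<ge>N. padic_abs_rat p (X m - X n) < e)"

definition padic_null :: "nat \<Rightarrow> (nat \<Rightarrow> rat) \<Rightarrow> bool" where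
  "padic_null p X \<longleftrightarrow> (\<lambda>n. padic_abs_rat p (X n)) \<longlonglongrightarrow> 0"

lemma padic_Cauchy_iff:
  "padic_Cauchy p X \<longleftrightarrow>
    ((\<lambda>mn. padic_abs_rat p (X (fst mn) - X (snd mn))) \<longlongrightarrow> 0) (sequentially \<times>\<^sub>F sequentially)"
  unfolding padic_Cauchy_def tendsto_iff eventually_prod_sequentially
  by (auto simp: dist_real_def) blast+

lemma padic_Cauchy_const: "padic_Cauchy p (\<lambda>_. c)"
  by (simp add: padic_Cauchy_def)

lemma padic_Cauchy_add:
  assumes p: "prime p" and X: "padic_Cauchy p X" and Y: "padic_Cauchy p Y"
  shows "padic_Cauchy p (\<lambda>n. X n + Y n)"
  unfolding padic_Cauchy_iff
proof (rule tendsto_sandwich[OF _ _ tendsto_const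
      tendsto_add_zero[OF X[unfolded padic_Cauchy_iff] Y[unfolded padic_Cauchy_iff]]])
  show "\<forall>\<^sub>F mn in sequentially \<times>\<^sub>F sequentially.
      padic_abs_rat p (X (fst mn) + Y (fst mn) - (X (snd mn) + Y (snd mn)))
      \<le> padic_abs_rat p (X (fst mn) - X (snd mn)) + padic_abs_rat p (Y (fst mn) - Y (snd mn))"
    using padic_abs_rat_triangle[OF p] by (auto simp: add_diff_add intro!: always_eventually)
qed auto

lemma padic_Cauchy_minus: "padic_Cauchy p X \<Longrightarrow> padic_Cauchy p (\<lambda>n. - X n)"
  unfolding padic_Cauchy_def using padic_abs_rat_diff_commute by (simp add: add.commute)

lemma padic_Cauchy_convergent_abs:
  assumes p: "prime p" and X: "padic_Cauchy p X"
  shows "convergent (\<lambda>n. padic_abs_rat p (X n))"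
proof -
  have "Cauchy (\<lambda>n. padic_abs_rat p (X n))"
  proof (rule metric_CauchyI)
    fix e :: real assume "e > 0"
    then obtain N where N: "\<forall>m\<ge>N. \<forall>n\<ge>N. padic_abs_rat p (X m - X n) < e"
      using X unfolding padic_Cauchy_def by blast
    have "\<forall>m\<ge>N. \<forall>n\<ge>N. dist (padic_abs_rat p (X m)) (padic_abs_rat p (X n)) < e"
      unfolding dist_real_def
      using N padic_abs_rat_reverse_triangle[OF p] le_less_trans by blast
    then show "\<exists>M. \<forall>m\<ge>M. \<forall>n\<ge>M. dist (padic_abs_rat p (X m)) (padic_abs_rat p (X n)) < e" ..
  qed
  then show ?thesis by (simp add: Cauchy_convergent_iff)
qed

lemma padic_Cauchy_tendsto_abs:
  assumes "prime p" and "padic_Cauchy p X"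
  shows "(\<lambda>n. padic_abs_rat p (X n)) \<longlonglongrightarrow> lim (\<lambda>n. padic_abs_rat p (X n))"
  using padic_Cauchy_convergent_abs[OF assms] by (simp add: convergent_LIMSEQ_iff)

lemma tendsto_fst_snd:
  assumes "f \<longlonglongrightarrow> l"
  shows "((\<lambda>mn. f (fst mn)) \<longlongrightarrow> l) (sequentially \<times>\<^sub>F sequentially)"
    and "((\<lambda>mn. f (snd mn)) \<longlongrightarrow> l) (sequentially \<times>\<^sub>F sequentially)"
  using filterlim_compose[OF assms filterlim_fst] filterlim_compose[OF assms filterlim_snd] by auto

lemma padic_abs_rat_mult_diff_le:
  assumes p: "prime p"
  shows "padic_abs_rat p (a * b - c * d)
    \<le> padic_abs_rat p a * padic_abs_rat p (b - d) + padic_abs_rat p (a - c) * padic_abs_rat p d"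
proof -
  have "a * b - c * d = a * (b - d) + (a - c) * d" by (simp add: algebra_simps)
  then show ?thesis
    using padic_abs_rat_triangle[OF p, of "a * (b - d)" "(a - c) * d"]
    by (simp add: padic_abs_rat_mult[OF p])
qed

lemma padic_Cauchy_mult:
  assumes p: "prime p" and X: "padic_Cauchy p X" and Y: "padic_Cauchy p Y"
  shows "padic_Cauchy p (\<lambda>n. X n * Y n)"
proof -
  note lX = padic_Cauchy_tendsto_abs[OF p X] and lY = padic_Cauchy_tendsto_abs[OF p Y]
  have "((\<lambda>mn. padic_abs_rat p (X (fst mn)) * padic_abs_rat p (Y (fst mn) - Y (snd mn))
      + padic_abs_rat p (X (fst mn) - X (snd mn)) * padic_abs_rat p (Y (snd mn))) \<longlongrightarrow>
      lim (\<lambda>n. padic_abs_rat p (X n)) * 0 + 0 * lim (\<lambda>n. padic_abs_rat p (Y n)))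
      (sequentially \<times>\<^sub>F sequentially)"
    using X Y unfolding padic_Cauchy_iff
    by (intro tendsto_add tendsto_mult tendsto_fst_snd lX lY)
  then have lim0: "((\<lambda>mn. padic_abs_rat p (X (fst mn)) * padic_abs_rat p (Y (fst mn) - Y (snd mn))
      + padic_abs_rat p (X (fst mn) - X (snd mn)) * padic_abs_rat p (Y (snd mn))) \<longlongrightarrow> 0)
      (sequentially \<times>\<^sub>F sequentially)" by simp
  show ?thesis
    unfolding padic_Cauchy_iff
    by (rule tendsto_sandwich[OF _ _ tendsto_const lim0])
      (auto intro!: always_eventually padic_abs_rat_mult_diff_le[OF p])
qed

lemma padic_null_add:
  assumes p: "prime p" and X: "padic_null p X" and Y: "padic_null p Y"
  shows "padic_null p (\<lambda>n. X n + Y n)"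
  unfolding padic_null_def
  by (rule tendsto_sandwich[OF _ _ tendsto_const
        tendsto_add_zero[OF X[unfolded padic_null_def] Y[unfolded padic_null_def]]])
    (auto intro!: always_eventually padic_abs_rat_triangle[OF p])

lemma padic_null_minus [simp]: "padic_null p (\<lambda>n. - X n) \<longleftrightarrow> padic_null p X"
  by (simp add: padic_null_def)

lemma padic_null_diff_commute: "padic_null p (\<lambda>n. X n - Y n) \<longleftrightarrow> padic_null p (\<lambda>n. Y n - X n)"
  by (simp add: padic_null_def padic_abs_rat_diff_commute)

lemma padic_null_zero: "padic_null p (\<lambda>n. 0)"
  by (simp add: padic_null_def)

lemma padic_null_mult_diff:
  assumes p: "prime p" and X: "padic_Cauchy p X" and W: "padic_Cauchy p W"
    and "padic_null p (\<lambda>n. X n - Y n)" and "padic_null p (\<lambda>n. Z n - W n)"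
  shows "padic_null p (\<lambda>n. X n * Z n - Y n * W n)"
proof -
  note lX = padic_Cauchy_tendsto_abs[OF p X] and lW = padic_Cauchy_tendsto_abs[OF p W]
  have "(\<lambda>n. padic_abs_rat p (X n) * padic_abs_rat p (Z n - W n)
      + padic_abs_rat p (X n - Y n) * padic_abs_rat p (W n)) \<longlonglongrightarrow>
      lim (\<lambda>n. padic_abs_rat p (X n)) * 0 + 0 * lim (\<lambda>n. padic_abs_rat p (W n))"
    using assms(4,5) unfolding padic_null_def
    by (intro tendsto_add tendsto_mult lX lW)
  then have lim0: "(\<lambda>n. padic_abs_rat p (X n) * padic_abs_rat p (Z n - W n)
      + padic_abs_rat p (X n - Y n) * padic_abs_rat p (W n)) \<longlonglongrightarrow> 0" by simp
  show ?thesis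
    unfolding padic_null_def
    by (rule tendsto_sandwich[OF _ _ tendsto_const lim0])
      (auto intro!: always_eventually padic_abs_rat_mult_diff_le[OF p])
qed

lemma padic_null_cong:
  assumes p: "prime p" and XY: "padic_null p (\<lambda>n. X n - Y n)"
  shows "padic_null p X \<longleftrightarrow> padic_null p Y"
proof
  assume "padic_null p X"
  then show "padic_null p Y"
    using padic_null_add[OF p, of X "\<lambda>n. Y n - X n"] padic_null_diff_commute[of p X Y] XY by simp
next
  assume "padic_null p Y"
  then show "padic_null p X"
    using padic_null_add[OF p, of Y "\<lambda>n. X n - Y n"] XY by simp
qed

lemma padic_not_null:
  assumes p: "prime p" and X: "padic_Cauchy p X" and nn: "\<not> padic_null p X"
  shows "lim (\<lambda>n. padic_abs_rat p (X n)) \<noteq> 0" and "\<forall>\<^sub>F n in sequentially. X n \<noteq> 0"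
proof -
  note l = padic_Cauchy_tendsto_abs[OF p X]
  show 1: "lim (\<lambda>n. padic_abs_rat p (X n)) \<noteq> 0" using l nn unfolding padic_null_def by auto
  show "\<forall>\<^sub>F n in sequentially. X n \<noteq> 0"
    using tendsto_imp_eventually_ne[OF l 1] by eventually_elim auto
qed

lemma padic_abs_rat_inverse_diff:
  assumes p: "prime p" and "a \<noteq> 0" and "b \<noteq> 0"
  shows "padic_abs_rat p (inverse a - inverse b) =
    padic_abs_rat p (a - b) * inverse (padic_abs_rat p a) * inverse (padic_abs_rat p b)"
proof -
  have "inverse a - inverse b = (b - a) * inverse a * inverse b"
    using assms by (simp add: field_simps)
  then show ?thesis
    by (simp add: padic_abs_rat_mult[OF p] padic_abs_rat_inverse[OF p] padic_abs_rat_diff_commute)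
qed

lemma padic_Cauchy_inverse:
  assumes p: "prime p" and X: "padic_Cauchy p X" and nn: "\<not> padic_null p X"
  shows "padic_Cauchy p (\<lambda>n. inverse (X n))"
proof -
  note l = padic_Cauchy_tendsto_abs[OF p X] and nz = padic_not_null[OF p X nn]
  let ?l = "lim (\<lambda>n. padic_abs_rat p (X n))"
  let ?F = "sequentially \<times>\<^sub>F sequentially"
  have "((\<lambda>mn. padic_abs_rat p (X (fst mn) - X (snd mn)) * inverse (padic_abs_rat p (X (fst mn)))
      * inverse (padic_abs_rat p (X (snd mn)))) \<longlongrightarrow> 0 * inverse ?l * inverse ?l) ?F"
    using X nz(1) unfolding padic_Cauchy_iff
    by (intro tendsto_mult tendsto_inverse tendsto_fst_snd[of "\<lambda>n. padic_abs_rat p (X n)"] l) auto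
  moreover have "\<forall>\<^sub>F mn in ?F. X (fst mn) \<noteq> 0 \<and> X (snd mn) \<noteq> 0"
    using nz(2) by (auto simp: eventually_prod_sequentially eventually_sequentially)
  then have "\<forall>\<^sub>F mn in ?F.
      padic_abs_rat p (X (fst mn) - X (snd mn)) * inverse (padic_abs_rat p (X (fst mn)))
        * inverse (padic_abs_rat p (X (snd mn)))
      = padic_abs_rat p (inverse (X (fst mn)) - inverse (X (snd mn)))"
    by eventually_elim (simp add: padic_abs_rat_inverse_diff[OF p])
  ultimately show ?thesis
    unfolding padic_Cauchy_iff by (simp add: tendsto_cong)
qed

lemma padic_null_inverse_diff:
  assumes p: "prime p" and X: "padic_Cauchy p X" and Y: "padic_Cauchy p Y"
    and nX: "\<not> padic_null p X" and nY: "\<not> padic_null p Y" and XY: "padic_null p (\<lambda>n. X n - Y n)"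
  shows "padic_null p (\<lambda>n. inverse (X n) - inverse (Y n))"
proof -
  note lX = padic_Cauchy_tendsto_abs[OF p X] and nzX = padic_not_null[OF p X nX]
  note lY = padic_Cauchy_tendsto_abs[OF p Y] and nzY = padic_not_null[OF p Y nY]
  have "(\<lambda>n. padic_abs_rat p (X n - Y n) * inverse (padic_abs_rat p (X n))
      * inverse (padic_abs_rat p (Y n))) \<longlonglongrightarrow>
      0 * inverse (lim (\<lambda>n. padic_abs_rat p (X n))) * inverse (lim (\<lambda>n. padic_abs_rat p (Y n)))"
    using XY nzX(1) nzY(1) unfolding padic_null_def
    by (intro tendsto_mult tendsto_inverse lX lY) auto
  moreover have "\<forall>\<^sub>F n in sequentially.
      padic_abs_rat p (X n - Y n) * inverse (padic_abs_rat p (X n)) * inverse (padic_abs_rat p (Y n))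
      = padic_abs_rat p (inverse (X n) - inverse (Y n))"
    using nzX(2) nzY(2) by eventually_elim (simp add: padic_abs_rat_inverse_diff[OF p])
  ultimately show ?thesis
    unfolding padic_null_def by (simp add: tendsto_cong)
qed

lemma padic_null_mult_inverse:
  assumes p: "prime p" and X: "padic_Cauchy p X" and nX: "\<not> padic_null p X"
  shows "padic_null p (\<lambda>n. inverse (X n) * X n - 1)"
proof -
  have "\<forall>\<^sub>F n in sequentially. padic_abs_rat p (inverse (X n) * X n - 1) = 0"
    using padic_not_null(2)[OF p X nX] by eventually_elim simp
  then show ?thesis unfolding padic_null_def by (rule tendsto_eventually)
qed

section \<open>The field of \<open>p\<close>-adic numbers\<close>

text \<open>
  The prime \<open>p\<close> is the cardinality of the type parameter \<open>'p\<close>, as for the type \<open>'p mod_ring\<close>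
  of integers modulo \<open>p\<close>.
\<close>

typedef (overloaded) 'p padic_Cauchy_seq = "{X. padic_Cauchy CARD('p::prime_card) X}"
  using padic_Cauchy_const by blast

setup_lifting type_definition_padic_Cauchy_seq

instantiation padic_Cauchy_seq :: (prime_card) comm_ring_1
begin

lift_definition zero_padic_Cauchy_seq :: "'a padic_Cauchy_seq" is "\<lambda>_. 0"
  by (rule padic_Cauchy_const)

lift_definition one_padic_Cauchy_seq :: "'a padic_Cauchy_seq" is "\<lambda>_. 1"
  by (rule padic_Cauchy_const)

lift_definition plus_padic_Cauchy_seq ::
  "'a padic_Cauchy_seq \<Rightarrow> 'a padic_Cauchy_seq \<Rightarrow> 'a padic_Cauchy_seq" is "\<lambda>X Y n. X n + Y n"
  by (rule padic_Cauchy_add[OF prime_card])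

lift_definition uminus_padic_Cauchy_seq ::
  "'a padic_Cauchy_seq \<Rightarrow> 'a padic_Cauchy_seq" is "\<lambda>X n. - X n"
  by (rule padic_Cauchy_minus)

lift_definition times_padic_Cauchy_seq ::
  "'a padic_Cauchy_seq \<Rightarrow> 'a padic_Cauchy_seq \<Rightarrow> 'a padic_Cauchy_seq" is "\<lambda>X Y n. X n * Y n"
  by (rule padic_Cauchy_mult[OF prime_card])

lift_definition minus_padic_Cauchy_seq ::
  "'a padic_Cauchy_seq \<Rightarrow> 'a padic_Cauchy_seq \<Rightarrow> 'a padic_Cauchy_seq" is "\<lambda>X Y n. X n - Y n"
  using padic_Cauchy_add[OF prime_card _ padic_Cauchy_minus] by fastforce

instance
  by standard (transfer; simp add: algebra_simps fun_eq_iff)+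

end

lift_definition padic_null_seq :: "'p::prime_card padic_Cauchy_seq \<Rightarrow> bool"
  is "padic_null CARD('p)" .

lift_definition padic_inverse_seq :: "'p::prime_card padic_Cauchy_seq \<Rightarrow> 'p padic_Cauchy_seq"
  is "\<lambda>X. if padic_null CARD('p) X then \<lambda>_. 0 else (\<lambda>n. inverse (X n))"
  by (simp add: padic_Cauchy_const padic_Cauchy_inverse[OF prime_card])

lift_definition padic_abs_seq :: "'p::prime_card padic_Cauchy_seq \<Rightarrow> real"
  is "\<lambda>X. lim (\<lambda>n. padic_abs_rat CARD('p) (X n))" .

definition padic_rel :: "'p::prime_card padic_Cauchy_seq \<Rightarrow> 'p padic_Cauchy_seq \<Rightarrow> bool" where
  "padic_rel X Y \<longleftrightarrow> padic_null_seq (X - Y)"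

lemma padic_null_seq_0 [simp]: "padic_null_seq 0"
  by transfer (rule padic_null_zero)

lemma padic_null_seq_add: "padic_null_seq X \<Longrightarrow> padic_null_seq Y \<Longrightarrow> padic_null_seq (X + Y)"
  by transfer (rule padic_null_add[OF prime_card])

lemma padic_null_seq_minus: "padic_null_seq (- X) \<longleftrightarrow> padic_null_seq X"
  by transfer simp

lemma padic_null_seq_mult_diff:
  "padic_null_seq (X - Y) \<Longrightarrow> padic_null_seq (Z - W) \<Longrightarrow> padic_null_seq (X * Z - Y * W)"
  by transfer (rule padic_null_mult_diff[OF prime_card])

lemma padic_null_seq_inverse_diff:
  "padic_null_seq (X - Y) \<Longrightarrow> padic_null_seq (padic_inverse_seq X - padic_inverse_seq Y)"
proof transfer
  fix X Y
  assume *: "padic_Cauchy CARD('a) X" "padic_Cauchy CARD('a) Y"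
    "padic_null CARD('a) (\<lambda>n. X n - Y n)"
  then have iff: "padic_null CARD('a) X \<longleftrightarrow> padic_null CARD('a) Y"
    by (intro padic_null_cong[OF prime_card])
  show "padic_null CARD('a)
      (\<lambda>n. (if padic_null CARD('a) X then \<lambda>_. 0 else (\<lambda>n. inverse (X n))) n -
           (if padic_null CARD('a) Y then \<lambda>_. 0 else (\<lambda>n. inverse (Y n))) n)"
  proof (cases "padic_null CARD('a) Y")
    case True
    then show ?thesis using iff by (simp add: padic_null_zero)
  next
    case False
    then show ?thesis using iff padic_null_inverse_diff[OF prime_card *(1,2) _ _ *(3)] by simp
  qed
qed

lemma padic_null_seq_mult_inverse:
  "\<not> padic_null_seq X \<Longrightarrow> padic_null_seq (padic_inverse_seq X * X - 1)"
  by transfer (simp add: padic_null_mult_inverse[OF prime_card])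

lemma padic_inverse_seq_0: "padic_inverse_seq 0 = 0"
  by transfer (simp add: padic_null_zero)

lemma not_padic_null_seq_1: "\<not> padic_null_seq 1"
  by transfer (simp add: padic_null_def LIMSEQ_const_iff)

lemma padic_abs_seq_cong:
  "padic_null_seq (X - Y) \<Longrightarrow> padic_abs_seq X = padic_abs_seq Y"
proof transfer
  fix X Y
  assume r: "padic_Cauchy CARD('a) X" "padic_Cauchy CARD('a) Y"
    "padic_null CARD('a) (\<lambda>n. X n - Y n)"
  have p: "prime CARD('a)" by (rule prime_card)
  have "(\<lambda>n. padic_abs_rat CARD('a) (X n) - padic_abs_rat CARD('a) (Y n)) \<longlonglongrightarrow> 0"
  proof (rule Lim_null_comparison)
    show "\<forall>\<^sub>F n in sequentially. norm (padic_abs_rat CARD('a) (X n) - padic_abs_rat CARD('a) (Y n))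
        \<le> padic_abs_rat CARD('a) (X n - Y n)"
      unfolding real_norm_def by (rule always_eventually, rule allI, rule padic_abs_rat_reverse_triangle[OF p])
    show "(\<lambda>n. padic_abs_rat CARD('a) (X n - Y n)) \<longlonglongrightarrow> 0"
      using r(3) unfolding padic_null_def .
  qed
  moreover have "(\<lambda>n. padic_abs_rat CARD('a) (X n) - padic_abs_rat CARD('a) (Y n)) \<longlonglongrightarrow>
      lim (\<lambda>n. padic_abs_rat CARD('a) (X n)) - lim (\<lambda>n. padic_abs_rat CARD('a) (Y n))"
    by (rule tendsto_diff[OF padic_Cauchy_tendsto_abs[OF p r(1)] padic_Cauchy_tendsto_abs[OF p r(2)]])
  ultimately have "0 = lim (\<lambda>n. padic_abs_rat CARD('a) (X n)) - lim (\<lambda>n. padic_abs_rat CARD('a) (Y n))"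
    by (rule LIMSEQ_unique)
  then show "lim (\<lambda>n. padic_abs_rat CARD('a) (X n)) = lim (\<lambda>n. padic_abs_rat CARD('a) (Y n))"
    by linarith
qed

lemma padic_rel_refl: "padic_rel X X"
  by (simp add: padic_rel_def)

quotient_type (overloaded) 'p padic = "'p::prime_card padic_Cauchy_seq" / padic_rel
proof (rule equivpI)
  show "reflp (padic_rel :: 'p padic_Cauchy_seq \<Rightarrow> _)"
    by (simp add: reflp_def padic_rel_refl)
  show "symp (padic_rel :: 'p padic_Cauchy_seq \<Rightarrow> _)"
  proof (rule sympI)
    show "padic_rel Y X" if "padic_rel X Y" for X Y :: "'p padic_Cauchy_seq"
      using that padic_null_seq_minus[of "X - Y"] by (simp add: padic_rel_def)
  qed
  show "transp (padic_rel :: 'p padic_Cauchy_seq \<Rightarrow> _)"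
  proof (rule transpI)
    show "padic_rel X Z" if "padic_rel X Y" "padic_rel Y Z" for X Y Z :: "'p padic_Cauchy_seq"
      using that padic_null_seq_add[of "X - Y" "Y - Z"] by (simp add: padic_rel_def)
  qed
qed

instantiation padic :: (prime_card) field
begin

lift_definition zero_padic :: "'a padic" is 0 .

lift_definition one_padic :: "'a padic" is 1 .

lift_definition plus_padic :: "'a padic \<Rightarrow> 'a padic \<Rightarrow> 'a padic" is "(+)"
  unfolding padic_rel_def add_diff_add by (rule padic_null_seq_add)

lift_definition uminus_padic :: "'a padic \<Rightarrow> 'a padic" is uminus
  unfolding padic_rel_def minus_diff_minus padic_null_seq_minus .

lift_definition minus_padic :: "'a padic \<Rightarrow> 'a padic \<Rightarrow> 'a padic" is "(-)"
proof -
  fix X X' Y Y' :: "'a padic_Cauchy_seq"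
  assume "padic_rel X X'" "padic_rel Y Y'"
  then show "padic_rel (X - Y) (X' - Y')"
    using padic_null_seq_add[of "X - X'" "- (Y - Y')"] padic_null_seq_minus[of "Y - Y'"]
    by (simp add: padic_rel_def algebra_simps)
qed

lift_definition times_padic :: "'a padic \<Rightarrow> 'a padic \<Rightarrow> 'a padic" is "(*)"
  unfolding padic_rel_def by (rule padic_null_seq_mult_diff)

lift_definition inverse_padic :: "'a padic \<Rightarrow> 'a padic" is padic_inverse_seq
  unfolding padic_rel_def by (rule padic_null_seq_inverse_diff)

definition divide_padic :: "'a padic \<Rightarrow> 'a padic \<Rightarrow> 'a padic" where
  "divide_padic x y = x * inverse y"

instance
proof
  fix a b c :: "'a padic"
  show "a + b + c = a + (b + c)"
    by transfer (simp add: padic_rel_refl add.assoc)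
  show "a + b = b + a"
    by transfer (simp add: padic_rel_refl add.commute)
  show "0 + a = a"
    by transfer (simp add: padic_rel_refl)
  show "- a + a = 0"
    by transfer (simp add: padic_rel_refl)
  show "a - b = a + - b"
    by transfer (simp add: padic_rel_refl)
  show "a * b * c = a * (b * c)"
    by transfer (simp add: padic_rel_refl mult.assoc)
  show "a * b = b * a"
    by transfer (simp add: padic_rel_refl mult.commute)
  show "1 * a = a"
    by transfer (simp add: padic_rel_refl)
  show "(a + b) * c = a * c + b * c"
    by transfer (simp add: padic_rel_refl distrib_right)
  show "(0 :: 'a padic) \<noteq> 1"
    by transfer (simp add: padic_rel_def padic_null_seq_minus not_padic_null_seq_1)
  show "a \<noteq> 0 \<Longrightarrow> inverse a * a = 1"
    by transfer (simp add: padic_rel_def padic_null_seq_mult_inverse)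
  show "a div b = a * inverse b"
    by (simp add: divide_padic_def)
  show "inverse (0 :: 'a padic) = 0"
    by transfer (simp add: padic_inverse_seq_0 padic_rel_refl)
qed

end

lift_definition padic_abs :: "'p::prime_card padic \<Rightarrow> real" is padic_abs_seq
  unfolding padic_rel_def by (rule padic_abs_seq_cong)

section \<open>Operators on \<open>\<rat>\<^sub>p\<^sup>d\<close>\<close>

definition padic_inner :: "'p::prime_card padic ^ 'd \<Rightarrow> 'p padic ^ 'd \<Rightarrow> 'p padic" where
  "padic_inner a b = (\<Sum>j\<in>UNIV. a $ j * b $ j)"

definition frame_operator ::
  "nat \<Rightarrow> (nat \<Rightarrow> 'p::prime_card padic ^ 'd) \<Rightarrow> 'p padic ^ 'd \<Rightarrow> 'p padic ^ 'd" where
  "frame_operator n \<tau> x = (\<Sum>j = 1..n. padic_inner x (\<tau> j) *s \<tau> j)"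

definition diagonal_operator :: "('d \<Rightarrow> 'a::field) \<Rightarrow> 'a ^ 'd \<Rightarrow> 'a ^ 'd" where
  "diagonal_operator eig x = (\<chi> i. eig i * x $ i)"

definition similar_operators :: "('a::field ^ 'd \<Rightarrow> 'a ^ 'd) \<Rightarrow> ('a ^ 'd \<Rightarrow> 'a ^ 'd) \<Rightarrow> bool" where
  "similar_operators S T \<longleftrightarrow>
     (\<exists>P Q. Vector_Spaces.linear (*s) (*s) P \<and> Vector_Spaces.linear (*s) (*s) Q \<and>
        Q \<circ> P = id \<and> P \<circ> Q = id \<and> S = Q \<circ> T \<circ> P)"

end

(* The trace of a matrix is invariant under similarity, so it can be computed from the eigenvalues
   or from the frame: sum of eig j = trace S = n, and
   sum of (eig j)^2 = trace S^2 = n + sum over j \<noteq> k of \<langle>\<tau> j, \<tau> k\<rangle>^2.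
   The ultrametric inequality for the last expression gives the bound. *)

theory Submission
  imports Defs
begin

text \<open>The first \<open>transfer\<close> passes from classes to Cauchy sequences, the second to
  the underlying sequences of rationals. There the absolute value is a limit, which inherits each
  law from \<open>padic_abs_rat\<close>.\<close>

lemma padic_abs_nonneg: "padic_abs x \<ge> 0"
proof transfer
  show "padic_abs_seq X \<ge> 0" for X :: "'a::prime_card padic_Cauchy_seq"
  proof transfer
    fix X assume X: "padic_Cauchy CARD('a) X"
    show "lim (\<lambda>n. padic_abs_rat CARD('a) (X n)) \<ge> 0"
      by (rule LIMSEQ_le_const[OF padic_Cauchy_tendsto_abs[OF prime_card X]]) auto
  qed
qed

lemma padic_abs_zero: "padic_abs 0 = 0"
  by transfer (transfer, simp)

lemma padic_abs_mult: "padic_abs (x * y) = padic_abs x * padic_abs y"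
proof transfer
  show "padic_abs_seq (X * Y) = padic_abs_seq X * padic_abs_seq Y"
    for X Y :: "'a::prime_card padic_Cauchy_seq"
  proof transfer
    fix X Y assume X: "padic_Cauchy CARD('a) X" and Y: "padic_Cauchy CARD('a) Y"
    show "lim (\<lambda>n. padic_abs_rat CARD('a) (X n * Y n)) =
        lim (\<lambda>n. padic_abs_rat CARD('a) (X n)) * lim (\<lambda>n. padic_abs_rat CARD('a) (Y n))"
      unfolding padic_abs_rat_mult[OF prime_card]
      by (intro limI tendsto_mult padic_Cauchy_tendsto_abs[OF prime_card] X Y)
  qed
qed

lemma padic_abs_ultrametric: "padic_abs (x + y) \<le> max (padic_abs x) (padic_abs y)"
proof transfer
  show "padic_abs_seq (X + Y) \<le> max (padic_abs_seq X) (padic_abs_seq Y)"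
    for X Y :: "'a::prime_card padic_Cauchy_seq"
  proof transfer
    fix X Y assume X: "padic_Cauchy CARD('a) X" and Y: "padic_Cauchy CARD('a) Y"
    note l = padic_Cauchy_tendsto_abs[OF prime_card]
    show "lim (\<lambda>n. padic_abs_rat CARD('a) (X n + Y n)) \<le>
        max (lim (\<lambda>n. padic_abs_rat CARD('a) (X n))) (lim (\<lambda>n. padic_abs_rat CARD('a) (Y n)))"
      \<comment> \<open>The left limit exists because the sum is again Cauchy; on the right,
        \<open>max\<close> is continuous.\<close>
      by (rule LIMSEQ_le[OF l[OF padic_Cauchy_add[OF prime_card X Y]] tendsto_max[OF l[OF X] l[OF Y]]])
        (use padic_abs_rat_ultrametric[OF prime_card] in blast)
  qed
qed

lemma padic_abs_power2: "padic_abs (x\<^sup>2) = (padic_abs x)\<^sup>2"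
  by (simp add: power2_eq_square padic_abs_mult)

text \<open>Iterated ultrametric inequality: the bound does not grow with the number of terms. The
  empty sum, and the sum over an infinite set, is 0, hence \<open>0 \<le> M\<close>.\<close>

lemma padic_abs_sum_le:
  assumes "\<And>x. x \<in> A \<Longrightarrow> padic_abs (f x) \<le> M" and "0 \<le> M"
  shows "padic_abs (\<Sum>x\<in>A. f x) \<le> M"
  using assms
proof (induction A rule: infinite_finite_induct)
  case (insert x A)
  then have "max (padic_abs (f x)) (padic_abs (sum f A)) \<le> M"
    by simp
  then show ?case
    using padic_abs_ultrametric[of "f x" "sum f A"] insert.hyps by (simp del: max.bounded_iff)
qed (auto simp: padic_abs_zero)

text \<open>Since tr(AB) = tr(BA), the matrix of \<open>Q\<close> can be moved behind that of
  \<open>P\<close>, where the two cancel. Linearity of \<open>T\<close> turns composition into a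
  matrix product.\<close>

lemma trace_similar_operators:
  fixes S T :: "'a::field ^ 'n \<Rightarrow> 'a ^ 'n"
  assumes "similar_operators S T" and T: "Vector_Spaces.linear (*s) (*s) T"
  shows "trace (matrix S) = trace (matrix T)"
proof -
  obtain P Q where P: "Vector_Spaces.linear (*s) (*s) P" and Q: "Vector_Spaces.linear (*s) (*s) Q"
    and PQ: "P \<circ> Q = id" and S: "S = Q \<circ> T \<circ> P"
    using assms unfolding similar_operators_def by blast
  have "matrix S = matrix Q ** (matrix T ** matrix P)"
    using P Q T by (simp add: S matrix_compose_gen Vector_Spaces.linear_compose matrix_mul_assoc)
  then have "trace (matrix S) = trace (matrix T ** (matrix P ** matrix Q))"
    by (metis trace_mul_sym matrix_mul_assoc)
  also have "matrix P ** matrix Q = mat 1"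
    using matrix_compose_gen[OF Q P] PQ by (simp add: matrix_def mat_def axis_def)
  finally show ?thesis by simp
qed

text \<open>The same \<open>P\<close> and \<open>Q\<close> work: the inner
  \<open>P \<circ> Q\<close> in QTPQTP cancels.\<close>

lemma similar_operators_square:
  assumes "similar_operators S T"
  shows "similar_operators (S \<circ> S) (T \<circ> T)"
proof -
  obtain P Q where P: "Vector_Spaces.linear (*s) (*s) P" and Q: "Vector_Spaces.linear (*s) (*s) Q"
    and QP: "Q \<circ> P = id" and PQ: "P \<circ> Q = id" and S: "S = Q \<circ> T \<circ> P"
    using assms unfolding similar_operators_def by blast
  have "P (Q x) = x" for x using PQ by (metis comp_apply id_apply)
  then have "S \<circ> S = Q \<circ> (T \<circ> T) \<circ> P" by (auto simp: S)
  then show ?thesis using P Q QP PQ unfolding similar_operators_def by blast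
qed

lemma linear_diagonal_operator: "Vector_Spaces.linear (*s) (*s) (diagonal_operator eig)"
  by unfold_locales (simp_all add: diagonal_operator_def vec_eq_iff algebra_simps)

lemma trace_diagonal_operator: "trace (matrix (diagonal_operator eig)) = (\<Sum>j\<in>UNIV. eig j)"
  by (simp add: trace_def matrix_def diagonal_operator_def axis_def)

lemma diagonal_operator_comp:
  "diagonal_operator a \<circ> diagonal_operator b = diagonal_operator (\<lambda>i. a i * b i)"
  by (auto simp: diagonal_operator_def vec_eq_iff mult.assoc)

lemma padic_inner_add_left: "padic_inner (x + y) z = padic_inner x z + padic_inner y z"
  by (simp add: padic_inner_def algebra_simps sum.distrib)

lemma padic_inner_scale_left: "padic_inner (c *s x) z = c * padic_inner x z"
  by (simp add: padic_inner_def sum_distrib_left mult.assoc)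

lemma linear_frame_operator: "Vector_Spaces.linear (*s) (*s) (frame_operator n \<tau>)"
  by unfold_locales
    (simp_all add: frame_operator_def padic_inner_add_left padic_inner_scale_left
      vec_eq_iff sum_distrib_left sum.distrib algebra_simps)

text \<open>The operator is a sum of rank-one maps with matrices t t^T, where t =
  \<open>\<tau> j\<close>. Column \<open>k\<close> is the image of a basis vector, and pairing with
  that vector reads off coordinate \<open>k\<close>.\<close>

lemma matrix_frame_operator:
  "matrix (frame_operator n \<tau>) $ i $ k = (\<Sum>j = 1..n. \<tau> j $ i * \<tau> j $ k)"
proof -
  have "padic_inner (axis k 1) x = x $ k" for x :: "'a::prime_card padic ^ 'b"
    by (simp add: padic_inner_def axis_def if_distrib[where f="\<lambda>a. a * _"] cong: if_cong)
  then show ?thesis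
    by (simp add: matrix_def frame_operator_def mult.commute)
qed

lemma trace_frame_operator:
  "trace (matrix (frame_operator n \<tau>)) = (\<Sum>j = 1..n. padic_inner (\<tau> j) (\<tau> j))"
  unfolding trace_def matrix_frame_operator padic_inner_def by (rule sum.swap)

text \<open>For vectors s and t, tr(s s^T t t^T) = (s^T t)^2; summing over all pairs gives the sum
  of the squared entries of the Gram matrix.\<close>

lemma trace_frame_operator_square:
  "trace (matrix (frame_operator n \<tau> \<circ> frame_operator n \<tau>))
    = (\<Sum>j = 1..n. \<Sum>k = 1..n. (padic_inner (\<tau> j) (\<tau> k))\<^sup>2)"
proof -
  let ?A = "matrix (frame_operator n \<tau>)"
  have "trace (matrix (frame_operator n \<tau> \<circ> frame_operator n \<tau>))
      = (\<Sum>i\<in>UNIV. \<Sum>m\<in>UNIV. ?A $ i $ m * ?A $ m $ i)"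
    by (simp add: matrix_compose_gen linear_frame_operator trace_def matrix_matrix_mult_def)
  \<comment> \<open>Each summand is regrouped into a factor in \<open>i\<close> and a factor in
    \<open>m\<close>. Four swaps then bring \<open>j\<close> and \<open>k\<close> outside, and the
    double sum over \<open>i\<close> and \<open>m\<close> factors into a square.\<close>
  also have "\<dots> = (\<Sum>i\<in>UNIV. \<Sum>m\<in>UNIV. \<Sum>j = 1..n. \<Sum>k = 1..n.
      (\<tau> j $ i * \<tau> k $ i) * (\<tau> j $ m * \<tau> k $ m))"
    unfolding matrix_frame_operator sum_product by (simp add: mult_ac)
  also have "\<dots> = (\<Sum>i\<in>UNIV. \<Sum>j = 1..n. \<Sum>m\<in>UNIV. \<Sum>k = 1..n.
      (\<tau> j $ i * \<tau> k $ i) * (\<tau> j $ m * \<tau> k $ m))"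
    by (intro sum.cong refl sum.swap)
  also have "\<dots> = (\<Sum>j = 1..n. \<Sum>i\<in>UNIV. \<Sum>m\<in>UNIV. \<Sum>k = 1..n.
      (\<tau> j $ i * \<tau> k $ i) * (\<tau> j $ m * \<tau> k $ m))"
    by (rule sum.swap)
  also have "\<dots> = (\<Sum>j = 1..n. \<Sum>i\<in>UNIV. \<Sum>k = 1..n. \<Sum>m\<in>UNIV.
      (\<tau> j $ i * \<tau> k $ i) * (\<tau> j $ m * \<tau> k $ m))"
    by (intro sum.cong refl sum.swap)
  also have "\<dots> = (\<Sum>j = 1..n. \<Sum>k = 1..n. \<Sum>i\<in>UNIV. \<Sum>m\<in>UNIV.
      (\<tau> j $ i * \<tau> k $ i) * (\<tau> j $ m * \<tau> k $ m))"
    by (intro sum.cong refl sum.swap)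
  also have "\<dots> = (\<Sum>j = 1..n. \<Sum>k = 1..n. (padic_inner (\<tau> j) (\<tau> k))\<^sup>2)"
    unfolding padic_inner_def power2_eq_square sum_product ..
  finally show ?thesis .
qed

theorem mainTheorem3:
  fixes n :: nat
    and \<tau> :: "nat \<Rightarrow> 'p::prime_card padic ^ 'd"
    and eig :: "'d \<Rightarrow> 'p padic"
  assumes unit: "\<And>j. j \<in> {1..n} \<Longrightarrow> padic_inner (\<tau> j) (\<tau> j) = 1"
    and diag: "similar_operators (frame_operator n \<tau>) (diagonal_operator eig)"
    and eigenvalues: "(padic_abs (\<Sum>j\<in>UNIV. eig j))\<^sup>2
        \<le> padic_abs (of_nat CARD('d) :: 'p padic) * padic_abs (\<Sum>j\<in>UNIV. (eig j)\<^sup>2)"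
  shows "(padic_abs (of_nat n :: 'p padic))\<^sup>2
    \<le> padic_abs (of_nat CARD('d) :: 'p padic) *
      Max ({padic_abs (of_nat n :: 'p padic)} \<union>
           {(padic_abs (padic_inner (\<tau> j) (\<tau> k)))\<^sup>2 | j k. j \<in> {1..n} \<and> k \<in> {1..n} \<and> j \<noteq> k})"
proof -
  let ?S = "frame_operator n \<tau>" and ?D = "diagonal_operator eig"
  let ?V = "{padic_abs (of_nat n :: 'p padic)} \<union>
    {(padic_abs (padic_inner (\<tau> j) (\<tau> k)))\<^sup>2 | j k. j \<in> {1..n} \<and> k \<in> {1..n} \<and> j \<noteq> k}"
  \<comment> \<open>Finiteness makes \<open>Max ?V\<close> an upper bound of
    \<open>?V\<close>.\<close>
  have "?V \<subseteq> {padic_abs (of_nat n :: 'p padic)} \<union>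
      (\<lambda>(j, k). (padic_abs (padic_inner (\<tau> j) (\<tau> k)))\<^sup>2) ` ({1..n} \<times> {1..n})"
    by auto
  then have fin: "finite ?V" by (rule finite_subset) simp
  have n_le: "padic_abs (of_nat n :: 'p padic) \<le> Max ?V"
    using fin by (intro Max_ge) auto
  have M0: "0 \<le> Max ?V"
    using n_le padic_abs_nonneg order_trans by blast
  have tr1: "(\<Sum>j\<in>UNIV. eig j) = of_nat n"
    using trace_similar_operators[OF diag linear_diagonal_operator] unit
    by (simp add: trace_diagonal_operator trace_frame_operator)
  have "(\<Sum>j\<in>UNIV. (eig j)\<^sup>2) = trace (matrix (?D \<circ> ?D))"
    by (simp add: diagonal_operator_comp trace_diagonal_operator power2_eq_square)
  also have "\<dots> = trace (matrix (?S \<circ> ?S))"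
    by (rule trace_similar_operators[OF similar_operators_square[OF diag], symmetric])
      (simp add: diagonal_operator_comp linear_diagonal_operator)
  also have "\<dots> = (\<Sum>j = 1..n. \<Sum>k = 1..n. (padic_inner (\<tau> j) (\<tau> k))\<^sup>2)"
    by (rule trace_frame_operator_square)
  \<comment> \<open>The diagonal term \<open>k = j\<close> is split off; it equals 1 by
    \<open>unit\<close>.\<close>
  also have "\<dots> = (\<Sum>j = 1..n. 1 + (\<Sum>k\<in>{1..n} - {j}. (padic_inner (\<tau> j) (\<tau> k))\<^sup>2))"
    by (intro sum.cong refl) (simp add: sum.remove unit)
  also have "\<dots> = of_nat n + (\<Sum>j = 1..n. \<Sum>k\<in>{1..n} - {j}. (padic_inner (\<tau> j) (\<tau> k))\<^sup>2)"
    by (simp add: sum.distrib)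
  finally have tr2: "(\<Sum>j\<in>UNIV. (eig j)\<^sup>2) = \<dots>" .
  have "padic_abs (\<Sum>j = 1..n. \<Sum>k\<in>{1..n} - {j}. (padic_inner (\<tau> j) (\<tau> k))\<^sup>2) \<le> Max ?V"
  \<comment> \<open>The sum bound is applied twice, to the outer and to the inner sum, which leaves
    a single off-diagonal term.\<close>
  proof (intro padic_abs_sum_le M0)
    fix j k assume "j \<in> {1..n}" "k \<in> {1..n} - {j}"
    then show "padic_abs ((padic_inner (\<tau> j) (\<tau> k))\<^sup>2) \<le> Max ?V"
      unfolding padic_abs_power2 by (intro Max_ge[OF fin]) blast
  qed
  then have "padic_abs (\<Sum>j\<in>UNIV. (eig j)\<^sup>2) \<le> Max ?V"
    unfolding tr2 using n_le padic_abs_ultrametric by (meson max.boundedI order_trans)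
  \<comment> \<open>By \<open>tr1\<close> the eigenvalue hypothesis bounds the square of |n|; the
    bound on the sum of squares is multiplied by |d|, which is nonnegative.\<close>
  then show ?thesis
    using eigenvalues unfolding tr1
    by (meson mult_left_mono order_trans padic_abs_nonneg)
qed

end
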